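(* Consider the randomized gossip algorithm with unreliable communication on $n\ge 3$ nodes, with node pair selection matrix $A=[a_{ij}]$ and communication probabilities $\{P_k^+\}_{k\ge0},\{P_k^-\}_{k\ge0}$ (as defined in the context). Suppose that the underlying digraph $\mathcal{G}_0$ is weakly connected and that communication is perfectly dependent, i.e. for every $k$ the events $\mathbb{E}_k^+$ and $\mathbb{E}_k^-$ coincide up to a set of probability zero. Then for all initial conditions $x^0=x(k_0)\in\mathbb{R}^n$, $$\mathbf{P}\Big(\sum_{i=1}^n x_i(k)=n\,x_{\rm ave}\ \text{ for all } k\ge k_0\Big)=1,$$ where $x_{\rm ave}=\frac1n\sum_{i=1}^n x_i(k_0)$. Consequently, $\mathbf{P}(\xi=x_{\rm ave})=1$ whenever the consensus limit $\xi$ exists.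
   Context: Network model. The node set is $\mathcal{V}=\{1,\dots,n\}$, $n\ge3$. $A=[a_{ij}]\in\mathbb{R}^{n\times n}$ is a stochastic matrix (nonnegative entries, each row sums to $1$). The underlying digraph is $\mathcal{G}_0=(\mathcal{V},\mathcal{E}_0)$ with $(j,i)\in\mathcal{E}_0$ if and only if $a_{ij}>0$. A digraph is weakly connected if it is connected as an undirected graph when arc directions are ignored. Node pair selection process. Independently at each time $k=0,1,2,\dots$, a node $i\in\mathcal{V}$ is drawn with probability $1/n$, and then node $i$ picks the (ordered) pair $(i,j)$ with probability $a_{ij}$. Node communication process. $\{P_k^+\}_{k\ge0}$ and $\{P_k^-\}_{k\ge0}$ are deterministic sequences in $[0,1]$. Independently over time, and independently of the node states and of the node pair selection process, $\mathbf{P}(\mathbb{E}_k^+)=P_k^+$ and $\mathbf{P}(\mathbb{E}_k^-)=P_k^-$, where $\mathbb{E}_k^+$ is the event that node $i$ receives $x_j(k)$ when $(i,j)$ is selected at time $k$, and $\mathbb{E}_k^-$ is the event that node $j$ receives $x_i(k)$ when $(i,j)$ is selected at time $k$. Algorithm. Let $k_0\ge0$ be an arbitrary integer initial time and $x(k_0)=x^0\in\mathbb{R}^n$ a deterministic initial condition. For $k\ge k_0$, $x_i(k+1)=\frac12x_i(k)+\frac12x_j(k)$ if $(i,j)$ or $(j,i)$ is selected at time $k$ and $i$ receives $x_j(k)$; otherwise $x_i(k+1)=x_i(k)$. Consensus limit. The consensus limit is a random variable $\xi=\xi(k_0,x^0)$ (when it exists) such that $\lim_{k\to\infty}x_i(k)=\xi$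 almost surely for every $i=1,\dots,n$. *)

theory Defs
  imports "Graph_Theory.Digraph_Component" "HOL-Probability.Probability"
begin

definition underlying_digraph :: "real ^ 'n ^ 'n \<Rightarrow> ('n, 'n \<times> 'n) pre_digraph" where
  "underlying_digraph A =
     \<lparr>verts = UNIV, arcs = {(j, i). A $ i $ j > 0}, tail = fst, head = snd\<rparr>"

text \<open>
  \<^const>\<open>Digraph_Component.connected\<close> is strong connectedness of the symmetrised digraph.
\<close>

definition weakly_connected :: "('v, 'e) pre_digraph \<Rightarrow> bool" where
  "weakly_connected G \<longleftrightarrow> Digraph_Component.connected G"

text \<open>
  The random variable \<open>sel k\<close> is the ordered pair selected at time \<open>k\<close>; its first component is
  the node that was drawn. The sets \<open>Ep k\<close> and \<open>Em k\<close> are the two reception events at time \<open>k\<close>.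
  Communication is independent over time as a process of pairs of indicators: within one time
  step, \<open>Ep k\<close> and \<open>Em k\<close> may depend on each other arbitrarily. The last assumption is
  independence of the sigma-algebras generated by the two whole processes; it is stated with
  \<open>indep_set\<close> because \<open>indep_var\<close> requires both random variables to have the same type.
\<close>

locale gossip_network = prob_space M for M :: "'a measure" +
  fixes A :: "real ^ 'n ^ 'n"
    and Pp Pm :: "nat \<Rightarrow> real"
    and sel :: "nat \<Rightarrow> 'a \<Rightarrow> 'n \<times> 'n"
    and Ep Em :: "nat \<Rightarrow> 'a set"
  assumes three_nodes: "CARD('n) \<ge> 3"
    and A_nonneg: "\<And>i j. A $ i $ j \<ge> 0"
    and A_row_sum: "\<And>i. (\<Sum>j\<in>UNIV. A $ i $ j) = 1"
    and node_drawn: "\<And>k i. \<P>(\<omega> in M. fst (sel k \<omega>) = i) = 1 / CARD('n)"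
    and node_picked:
      "\<And>k i j. \<P>(\<omega> in M. snd (sel k \<omega>) = j \<bar> fst (sel k \<omega>) = i) = A $ i $ j"
    and sel_indep: "indep_vars (\<lambda>_. count_space UNIV) sel UNIV"
    and Pp_range: "\<And>k. Pp k \<in> {0..1}"
    and Pm_range: "\<And>k. Pm k \<in> {0..1}"
    and Ep_event: "\<And>k. Ep k \<in> events"
    and Em_event: "\<And>k. Em k \<in> events"
    and Ep_prob: "\<And>k. prob (Ep k) = Pp k"
    and Em_prob: "\<And>k. prob (Em k) = Pm k"
    and comm_indep:
      "indep_vars (\<lambda>_. count_space UNIV) (\<lambda>k \<omega>. (\<omega> \<in> Ep k, \<omega> \<in> Em k)) UNIV"
    and sel_comm_indep:
      "indep_set
         (sets (vimage_algebra (space M) (\<lambda>\<omega> k. sel k \<omega>)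
                  (\<Pi>\<^sub>M k\<in>UNIV. count_space UNIV)))
         (sets (vimage_algebra (space M) (\<lambda>\<omega> k. (\<omega> \<in> Ep k, \<omega> \<in> Em k))
                  (\<Pi>\<^sub>M k\<in>UNIV. count_space UNIV)))"

text \<open>
  In \<open>gossip_step s p m x\<close> the flag \<open>p\<close> says that the first node of \<open>s\<close> receives the state of the
  second one, and \<open>m\<close> that the second receives the state of the first. For a pair \<open>(u, u)\<close> the
  state is unchanged whatever the flags.
\<close>

definition gossip_step ::
    "'n \<times> 'n \<Rightarrow> bool \<Rightarrow> bool \<Rightarrow> real ^ 'n \<Rightarrow> real ^ 'n" where
  "gossip_step s p m x =
     (case s of (u, v) \<Rightarrow> \<chi> i.
        if i = u \<and> p then 1/2 * x $ i + 1/2 * x $ v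
        else if i = v \<and> m then 1/2 * x $ i + 1/2 * x $ u
        else x $ i)"

text \<open>
  The state is meant for times \<open>k \<ge> k0\<close>; before \<open>k0\<close> it is set to \<open>x0\<close> by convention.
\<close>

primrec gossip_state ::
    "(nat \<Rightarrow> 'a \<Rightarrow> 'n \<times> 'n) \<Rightarrow> (nat \<Rightarrow> 'a set) \<Rightarrow> (nat \<Rightarrow> 'a set) \<Rightarrow>
     nat \<Rightarrow> real ^ 'n \<Rightarrow> nat \<Rightarrow> 'a \<Rightarrow> real ^ 'n" where
  "gossip_state sel Ep Em k0 x0 0 \<omega> = x0"
| "gossip_state sel Ep Em k0 x0 (Suc k) \<omega> =
     (if k0 \<le> k
      then gossip_step (sel k \<omega>) (\<omega> \<in> Ep k) (\<omega> \<in> Em k) (gossip_state sel Ep Em k0 x0 k \<omega>)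
      else x0)"

definition perfectly_dependent ::
    "'a measure \<Rightarrow> (nat \<Rightarrow> 'a set) \<Rightarrow> (nat \<Rightarrow> 'a set) \<Rightarrow> bool" where
  "perfectly_dependent M Ep Em \<longleftrightarrow> (\<forall>k. AE \<omega> in M. \<omega> \<in> Ep k \<longleftrightarrow> \<omega> \<in> Em k)"

definition consensus_limit ::
    "'a measure \<Rightarrow> (nat \<Rightarrow> 'a \<Rightarrow> real ^ 'n) \<Rightarrow> ('a \<Rightarrow> real) \<Rightarrow> bool" where
  "consensus_limit M x \<xi> \<longleftrightarrow>
     \<xi> \<in> borel_measurable M \<and> (\<forall>i. AE \<omega> in M. (\<lambda>k. x k \<omega> $ i) \<longlonglongrightarrow> \<xi> \<omega>)"

definition average :: "real ^ 'n \<Rightarrow> real" where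
  "average x = (1 / CARD('n)) * (\<Sum>i\<in>UNIV. x $ i)"

end

theory Submission
  imports Defs
begin

text \<open>
  When both or neither of the two messages arrive, the selected nodes move by opposite amounts, so
  a single step preserves the sum of the states. Perfect dependence holds almost surely at each of
  the countably many times, hence almost surely at all of them.
\<close>

lemma sum_gossip_step:
  "(\<Sum>i\<in>UNIV. gossip_step s p p x $ i) = (\<Sum>i\<in>UNIV. x $ i)"
proof -
  obtain u v where s: "s = (u, v)"
    by (cases s)
  \<comment> \<open>The nested conditionals become two additive corrections of opposite sign. This
    covers \<open>u = v\<close> too, since both corrections then vanish.\<close>
  have "gossip_step s p p x $ i = x $ i + (if i = u then (if p then (x $ v - x $ u) / 2 else 0) else 0)
      + (if i = v then (if p then (x $ u - x $ v) / 2 else 0) else 0)" for i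
    by (auto simp: gossip_step_def s field_simps)
  then have "(\<Sum>i\<in>UNIV. gossip_step s p p x $ i) = (\<Sum>i\<in>UNIV. x $ i)
      + (if p then (x $ v - x $ u) / 2 else 0) + (if p then (x $ u - x $ v) / 2 else 0)"
    by (simp add: sum.distrib)
  then show ?thesis
    by (simp add: field_simps)
qed

text \<open>A pathwise invariant: equal flags make every step sum-preserving. Up to time
  \<open>k0\<close> the state is \<open>x0\<close> by convention, so the induction can start at 0
  rather than at \<open>k0\<close>.\<close>

lemma sum_gossip_state:
  assumes "\<And>k. \<omega> \<in> Ep k \<longleftrightarrow> \<omega> \<in> Em k"
  shows "(\<Sum>i\<in>UNIV. gossip_state sel Ep Em k0 x0 k \<omega> $ i) = (\<Sum>i\<in>UNIV. x0 $ i)"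
  by (induction k) (simp_all add: assms sum_gossip_step)

lemma card_times_average: "CARD('n) * average (x :: real ^ 'n) = (\<Sum>i\<in>UNIV. x $ i)"
  by (simp add: average_def)

context gossip_network
begin

text \<open>Serves to pass from an almost sure identity to the probability of an event.\<close>

lemma gossip_state_measurable:
  "(\<lambda>\<omega>. gossip_state sel Ep Em k0 x0 k \<omega> $ i) \<in> borel_measurable M"
proof (induction k arbitrary: i)
  case 0
  show ?case by simp
next
  case (Suc k)
  note [measurable] = Suc.IH Ep_event Em_event
  have [measurable]: "sel k \<in> measurable M (count_space UNIV)"
    using sel_indep by (simp add: indep_vars_def)
  \<comment> \<open>The selected pair is first frozen at a value \<open>s\<close>. As it takes only
    finitely many values, these measurable functions can then be glued along
    \<open>sel k\<close>.\<close>
  have "(\<lambda>\<omega>. gossip_step s (\<omega> \<in> Ep k) (\<omega> \<in> Em k) (gossip_state sel Ep Em k0 x0 k \<omega>) $ i)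
      \<in> borel_measurable M" for s
    by (cases s) (simp add: gossip_step_def)
  then have "(\<lambda>\<omega>. gossip_step (sel k \<omega>) (\<omega> \<in> Ep k) (\<omega> \<in> Em k)
      (gossip_state sel Ep Em k0 x0 k \<omega>) $ i) \<in> borel_measurable M"
    by (rule measurable_compose_countable'[where I = UNIV]) (auto intro: countable_finite)
  then show ?case
    by (cases "k0 \<le> k") simp_all
qed

lemma AE_sum_gossip_state:
  assumes "perfectly_dependent M Ep Em"
  shows "AE \<omega> in M. \<forall>k. (\<Sum>i\<in>UNIV. gossip_state sel Ep Em k0 x0 k \<omega> $ i) = CARD('n) * average x0"
proof -
  have "AE \<omega> in M. \<forall>k. \<omega> \<in> Ep k \<longleftrightarrow> \<omega> \<in> Em k"
    using assms by (simp add: perfectly_dependent_def AE_all_countable)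
  then show ?thesis
    by eventually_elim (simp add: sum_gossip_state card_times_average)
qed

text \<open>Summing the finitely many coordinate limits shows that the total state tends to n times
  \<open>\<xi>\<close>; but the total is almost surely constant in time, and limits are
  unique.\<close>

lemma AE_consensus_limit_eq_average:
  assumes "perfectly_dependent M Ep Em"
    and "consensus_limit M (gossip_state sel Ep Em k0 x0) \<xi>"
  shows "AE \<omega> in M. \<xi> \<omega> = average x0"
proof -
  \<comment> \<open>There are finitely many nodes, so their exceptional null sets merge into
    one.\<close>
  have "AE \<omega> in M. \<forall>i. (\<lambda>k. gossip_state sel Ep Em k0 x0 k \<omega> $ i) \<longlonglongrightarrow> \<xi> \<omega>"
    using assms(2) by (simp add: consensus_limit_def AE_all_countable)
  moreover note AE_sum_gossip_state[OF assms(1), of k0 x0]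
  ultimately show ?thesis
  proof eventually_elim
    case (elim \<omega>)
    have "(\<lambda>k. \<Sum>i\<in>UNIV. gossip_state sel Ep Em k0 x0 k \<omega> $ i) \<longlonglongrightarrow> (\<Sum>i\<in>(UNIV :: 'n set). \<xi> \<omega>)"
      using elim(1) by (intro tendsto_sum) simp
    then have "CARD('n) * average x0 = CARD('n) * \<xi> \<omega>"
      using elim(2) by (simp add: LIMSEQ_const_iff)
    then show ?case
      by simp
  qed
qed

end

theorem theorem3:
  fixes M :: "'a measure"
    and A :: "real ^ 'n ^ 'n"
    and Pp Pm :: "nat \<Rightarrow> real"
    and sel :: "nat \<Rightarrow> 'a \<Rightarrow> 'n \<times> 'n"
    and Ep Em :: "nat \<Rightarrow> 'a set"
  assumes "gossip_network M A Pp Pm sel Ep Em"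
    and "weakly_connected (underlying_digraph A)"
    and "perfectly_dependent M Ep Em"
  shows "\<forall>k0 x0.
     \<P>(\<omega> in M. \<forall>k\<ge>k0.
        (\<Sum>i\<in>UNIV. gossip_state sel Ep Em k0 x0 k \<omega> $ i) = CARD('n) * average x0) = 1 \<and>
     (\<forall>\<xi>. consensus_limit M (gossip_state sel Ep Em k0 x0) \<xi> \<longrightarrow>
        \<P>(\<omega> in M. \<xi> \<omega> = average x0) = 1)"
proof (intro allI conjI impI)
  interpret gossip_network M A Pp Pm sel Ep Em
    by (fact assms(1))
  fix k0 :: nat and x0 :: "real ^ 'n"
  let ?S = "\<lambda>k \<omega>. \<Sum>i\<in>UNIV. gossip_state sel Ep Em k0 x0 k \<omega> $ i"
  have [measurable]: "?S k \<in> borel_measurable M" for k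
    by (intro borel_measurable_sum gossip_state_measurable)
  \<comment> \<open>A non-measurable set has measure 0 by convention, so almost sure truth alone
    would not give probability 1. Here the set is a countable intersection of events.\<close>
  have "{\<omega> \<in> space M. \<forall>k\<ge>k0. ?S k \<omega> = CARD('n) * average x0} \<in> events"
    by measurable
  moreover have "AE \<omega> in M. \<forall>k\<ge>k0. ?S k \<omega> = CARD('n) * average x0"
    using AE_sum_gossip_state[OF assms(3)] by eventually_elim blast
  ultimately show "\<P>(\<omega> in M. \<forall>k\<ge>k0. ?S k \<omega> = CARD('n) * average x0) = 1"
    by (simp only: prob_Collect_eq_1)
  fix \<xi>
  assume lim: "consensus_limit M (gossip_state sel Ep Em k0 x0) \<xi>"
  then have [measurable]: "\<xi> \<in> borel_measurable M"
    by (simp add: consensus_limit_def)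
  have "{\<omega> \<in> space M. \<xi> \<omega> = average x0} \<in> events"
    by measurable
  then show "\<P>(\<omega> in M. \<xi> \<omega> = average x0) = 1"
    using AE_consensus_limit_eq_average[OF assms(3) lim] by (simp only: prob_Collect_eq_1)
qed

end
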